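(* For every integer $n\ge 0$ and every real number $x$, $$\mathrm{Bel}_{n}(1-x)=\sum_{j=0}^{n}\sum_{l=0}^{j}\binom{n}{j}(-1)^{l}D_{l}(x)S_{2}(j,l),$$ and $$D_{n}(x)=\sum_{l=0}^{n}\sum_{m=0}^{l}\binom{l}{m}\mathrm{Bel}_{m}(1-x)(-1)^{n-m-l}S_{1}(n,l).$$
   Context: The derangement polynomials $D_n(x)$, $n\ge 0$, are defined by the generating function (formal power series in $t$) $\displaystyle\frac{e^{-t}}{1-t}e^{xt}=\sum_{n=0}^{\infty}D_{n}(x)\frac{t^{n}}{n!}$. The Bell polynomials $\mathrm{Bel}_n(x)$ are defined by $\displaystyle e^{x(e^{t}-1)}=\sum_{n=0}^{\infty}\mathrm{Bel}_{n}(x)\frac{t^{n}}{n!}$. Put $(x)_0=1$ and $(x)_n=x(x-1)\cdots(x-n+1)$ for $n\ge 1$. The (signed) Stirling numbers of the first kind $S_1(n,l)$ are defined by $(x)_n=\sum_{l=0}^{n}S_1(n,l)x^l$ for $n\ge 0$, and the Stirling numbers of the second kind $S_2(n,l)$ by $x^n=\sum_{l=0}^{n}S_2(n,l)(x)_l$ for $n\ge 0$. *)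

theory Defs
  imports
    "HOL-Computational_Algebra.Computational_Algebra"
    "HOL-Combinatorics.Stirling"
begin

definition derangement_poly :: "nat \<Rightarrow> real \<Rightarrow> real" where
  "derangement_poly n x =
     fact n * fps_nth (fps_exp (- 1) / (1 - fps_X) * fps_exp x) n"

lemma derangement_poly_egf:
  "fps_exp (- 1) / (1 - fps_X) * fps_exp x = Abs_fps (\<lambda>n. derangement_poly n x / fact n)"
  by (simp add: fps_eq_iff derangement_poly_def)

text \<open>Since \<open>fps_exp 1 - 1\<close> has zero constant coefficient, the composition
  \<open>fps_exp x oo (fps_exp 1 - 1)\<close> is the formal power series of \<open>exp (x * (exp t - 1))\<close> in \<open>t\<close>.\<close>

definition Bell_poly :: "nat \<Rightarrow> real \<Rightarrow> real" where
  "Bell_poly n x = fact n * fps_nth (fps_exp x oo (fps_exp 1 - 1)) n"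

lemma Bell_poly_egf:
  "fps_exp x oo (fps_exp 1 - 1) = Abs_fps (\<lambda>n. Bell_poly n x / fact n)"
  by (simp add: fps_eq_iff Bell_poly_def)

definition falling_fact :: "'a::comm_ring_1 \<Rightarrow> nat \<Rightarrow> 'a" where
  "falling_fact x n = (\<Prod>k<n. x - of_nat k)"

text \<open>The signed Stirling numbers of the first kind are the coefficients of the falling factorial
  of the indeterminate \<open>[:0, 1:]\<close>; the library function \<^const>\<open>stirling\<close> is the unsigned version.\<close>

definition signed_stirling :: "nat \<Rightarrow> nat \<Rightarrow> int" where
  "signed_stirling n l = coeff (falling_fact [:0, 1:] n) l"

lemma falling_fact_0 [simp]: "falling_fact x 0 = 1"
  by (simp add: falling_fact_def)

lemma falling_fact_Suc: "falling_fact x (Suc n) = falling_fact x n * (x - of_nat n)"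
  by (simp add: falling_fact_def)

lemma signed_stirling_0: "signed_stirling 0 l = (if l = 0 then 1 else 0)"
  by (simp add: signed_stirling_def coeff_1)

lemma signed_stirling_Suc:
  "signed_stirling (Suc n) l =
     (if l = 0 then 0 else signed_stirling n (l - 1)) - int n * signed_stirling n l"
proof -
  let ?p = "falling_fact [:0, 1:] n :: int poly"
  have "falling_fact [:0, 1:] (Suc n) = pCons 0 ?p - smult (int n) ?p"
    by (simp add: falling_fact_Suc right_diff_distrib of_nat_poly)
  then show ?thesis
    by (simp add: signed_stirling_def coeff_pCons split: nat.split)
qed

lemma signed_stirling_less [simp]: "n < l \<Longrightarrow> signed_stirling n l = 0"
  by (induction n arbitrary: l) (auto simp: signed_stirling_0 signed_stirling_Suc)

lemma falling_fact_eq_sum_signed_stirling: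
  fixes x :: real
  shows "falling_fact x n = (\<Sum>l\<le>n. of_int (signed_stirling n l) * x ^ l)"
proof (induction n)
  case 0
  show ?case by (simp add: signed_stirling_0)
next
  case (Suc n)
  let ?s = "\<lambda>l. real_of_int (signed_stirling n l)"
  have "(\<Sum>l\<le>Suc n. of_int (signed_stirling (Suc n) l) * x ^ l)
      = (\<Sum>l\<le>Suc n. (if l = 0 then 0 else ?s (l - 1)) * x ^ l)
        - (\<Sum>l\<le>Suc n. real n * (?s l * x ^ l))"
    by (subst sum_subtractf [symmetric], rule sum.cong)
       (simp_all add: signed_stirling_Suc algebra_simps)
  also have "(\<Sum>l\<le>Suc n. (if l = 0 then 0 else ?s (l - 1)) * x ^ l) = (\<Sum>l\<le>n. x * (?s l * x ^ l))"
    by (subst sum.atMost_Suc_shift) (simp add: mult_ac)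
  also have "\<dots> = x * falling_fact x n"
    by (simp add: Suc sum_distrib_left)
  also have "(\<Sum>l\<le>Suc n. real n * (?s l * x ^ l)) = real n * falling_fact x n"
    by (simp add: Suc sum_distrib_left)
  finally show ?case
    by (simp add: falling_fact_Suc algebra_simps)
qed

text \<open>The numbers \<^term>\<open>Stirling n l\<close>, which the library introduces by their recurrence, are the
  unique coefficients expressing \<open>x ^ n\<close> through falling factorials.\<close>

lemma power_eq_sum_Stirling:
  fixes x :: real
  shows "x ^ n = (\<Sum>l\<le>n. real (Stirling n l) * falling_fact x l)"
proof (induction n)
  case (Suc n)
  have step: "x * falling_fact x l = falling_fact x (Suc l) + real l * falling_fact x l" for l
    by (simp add: falling_fact_Suc algebra_simps)
  have "x ^ Suc n = (\<Sum>l\<le>n. real (Stirling n l) * (x * falling_fact x l))"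
    by (simp add: Suc sum_distrib_left mult_ac)
  also have "\<dots> = (\<Sum>l\<le>n. real (Stirling n l) * falling_fact x (Suc l))
                  + (\<Sum>l\<le>n. real (l * Stirling n l) * falling_fact x l)"
    by (simp add: step ring_distribs sum.distrib mult_ac)
  also have "(\<Sum>l\<le>n. real (l * Stirling n l) * falling_fact x l)
           = (\<Sum>l\<le>Suc n. real (l * Stirling n l) * falling_fact x l)"
    by simp
  also have "\<dots> = (\<Sum>l\<le>n. real (Suc l * Stirling n (Suc l)) * falling_fact x (Suc l))"
    by (subst sum.atMost_Suc_shift) simp
  also have "(\<Sum>l\<le>n. real (Stirling n l) * falling_fact x (Suc l)) + \<dots>
           = (\<Sum>l\<le>n. real (Stirling (Suc n) (Suc l)) * falling_fact x (Suc l))"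
    by (subst sum.distrib [symmetric], rule sum.cong) (simp_all add: algebra_simps)
  also have "\<dots> = (\<Sum>l\<le>Suc n. real (Stirling (Suc n) l) * falling_fact x l)"
    by (subst sum.atMost_Suc_shift) simp
  finally show ?case .
qed simp

lemma Stirling_unique:
  fixes a :: "nat \<Rightarrow> real"
  assumes "\<And>x::real. x ^ n = (\<Sum>l\<le>n. a l * falling_fact x l)" and "l \<le> n"
  shows "a l = real (Stirling n l)"
  using \<open>l \<le> n\<close>
proof (induction l rule: less_induct)
  case (less l)
  let ?c = "\<lambda>k. a k - real (Stirling n k)"
  have zero: "?c k * falling_fact (real l) k = 0" if "k \<in> {..n} - {l}" for k
  proof (cases "k < l")
    case True
    then show ?thesis using less that by simp
  next
    case False
    with that have "falling_fact (real l) k = 0"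
      unfolding falling_fact_def by (intro prod_zero) auto
    then show ?thesis by simp
  qed
  have "0 = (\<Sum>k\<le>n. ?c k * falling_fact (real l) k)"
    using assms(1)[of "real l"] power_eq_sum_Stirling[of "real l" n]
    by (simp add: left_diff_distrib sum_subtractf)
  also have "\<dots> = ?c l * falling_fact (real l) l"
    using less.prems by (subst sum.remove [of _ l]) (simp_all add: sum.neutral zero del: mult_eq_0_iff)
  finally have "?c l * falling_fact (real l) l = 0" by simp
  moreover have "falling_fact (real l) l \<noteq> 0"
    unfolding falling_fact_def by simp
  ultimately show ?case by simp
qed

end

theory Submission
  imports Defs
begin

text \<open>
  Write \<open>H = exp t - 1\<close> and let \<open>F\<close> be the exponential generating function of \<open>D\<^sub>n(x)\<close>, so that
  \<open>(1 - t) F(t) = exp ((x - 1) t)\<close>. Putting \<open>-H\<close> for \<open>t\<close> turns the factor \<open>1 - t\<close> into \<open>exp t\<close>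
  and the right-hand side into \<open>exp ((1 - x) H)\<close>, which is the generating function of
  \<open>Bel\<^sub>n(1 - x)\<close>:
    \<open>exp t * F(-H) = exp ((1 - x) H)\<close>.
  Both identities are readings of this single equation (\<open>Bell_fps_eq_exp_mult_derangement_fps\<close>).

  Since \<open>H ^ l / l!\<close> is the generating function of the numbers \<open>S\<^sub>2(j, l)\<close>
  (\<open>fps_nth_exp_minus_one_power\<close>), the series \<open>F(-H)\<close> generates the numbers
  \<open>b\<^sub>j = (\<Sum>l\<le>j. (-1) ^ l D\<^sub>l(x) S\<^sub>2(j, l))\<close>. Multiplication by \<open>exp t\<close> is a binomial
  convolution, and this gives the first identity. Multiplying by \<open>exp (-t)\<close> instead expresses
  the \<open>b\<^sub>l\<close> through the \<open>Bel\<^sub>m(1 - x)\<close>; the orthogonality of the two kinds of Stirling numbers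
  (\<open>sum_signed_stirling_Stirling\<close>) then recovers \<open>(-1) ^ n D\<^sub>n(x)\<close> from the \<open>b\<^sub>l\<close>, and this
  gives the second.
\<close>

text \<open>The derivative of \<open>H ^ k\<close>, with \<open>H = exp t - 1\<close>, is \<open>k H ^ (k - 1) (H + 1)\<close>; comparing
  coefficients yields the recurrence of the Stirling numbers of the second kind.\<close>

lemma fps_nth_exp_minus_one_power:
  "fact n * fps_nth ((fps_exp 1 - 1 :: real fps) ^ k) n = fact k * real (Stirling n k)"
proof (induction n arbitrary: k)
  case 0
  show ?case
    by (cases k) simp_all
next
  case (Suc n)
  let ?H = "fps_exp 1 - 1 :: real fps"
  show ?case
  proof (cases k)
    case 0
    then show ?thesis by simp
  next
    case (Suc m)
    have "fps_deriv (?H ^ Suc m) = fps_const (real (Suc m)) * (?H ^ Suc m + ?H ^ m)"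
    proof -
      have "fps_deriv (?H ^ Suc m) = fps_const (real (Suc m)) * (fps_deriv ?H * ?H ^ m)"
        by (simp only: fps_deriv_power diff_Suc_1 mult.assoc)
      also have "fps_deriv ?H = ?H + 1"
        by simp
      finally show ?thesis
        by (simp only: distrib_right power_Suc mult_1_left)
    qed
    then have "real (Suc n) * fps_nth (?H ^ Suc m) (Suc n)
        = real (Suc m) * (fps_nth (?H ^ Suc m) n + fps_nth (?H ^ m) n)"
      by (metis fps_deriv_nth Suc_eq_plus1 fps_mult_left_const_nth fps_add_nth)
    then have "fact (Suc n) * fps_nth (?H ^ Suc m) (Suc n)
        = real (Suc m) * (fact n * fps_nth (?H ^ Suc m) n + fact n * fps_nth (?H ^ m) n)"
      by (simp add: fact_Suc algebra_simps del: of_nat_Suc power_Suc)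
    also have "\<dots> = fact (Suc m) * real (Stirling (Suc n) (Suc m))"
      by (simp only: Suc.IH) (simp add: algebra_simps)
    finally show ?thesis
      using Suc by simp
  qed
qed

lemma fps_nth_power_minus:
  fixes f :: "'a::comm_ring_1 fps"
  shows "fps_nth ((- f) ^ k) n = (- 1) ^ k * fps_nth (f ^ k) n"
  by (cases "even k") simp_all

lemma fps_compose_minus_exp_minus_one_nth:
  fixes a :: "nat \<Rightarrow> real"
  shows "fact n * fps_nth (Abs_fps (\<lambda>k. a k / fact k) oo (- (fps_exp 1 - 1))) n
       = (\<Sum>l=0..n. (- 1) ^ l * a l * real (Stirling n l))"
proof -
  let ?H = "fps_exp 1 - 1 :: real fps"
  have "fact n * (a l / fact l * fps_nth ((- ?H) ^ l) n) = (- 1) ^ l * a l * real (Stirling n l)" for l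
  proof -
    have "fact n * (a l / fact l * fps_nth ((- ?H) ^ l) n)
        = (- 1) ^ l * a l / fact l * (fact n * fps_nth (?H ^ l) n)"
      by (simp only: fps_nth_power_minus times_divide_eq_left times_divide_eq_right mult_ac)
    then show ?thesis
      by (simp only: fps_nth_exp_minus_one_power) simp
  qed
  then show ?thesis
    by (simp add: fps_compose_nth sum_distrib_left)
qed

lemma fps_exp_mult_nth:
  fixes c :: real
  shows "fact n * fps_nth (fps_exp c * f) n
       = (\<Sum>j=0..n. real (n choose j) * c ^ (n - j) * (fact j * fps_nth f j))"
proof -
  have "fact n * (fps_nth f j * (c ^ (n - j) / fact (n - j)))
      = real (n choose j) * c ^ (n - j) * (fact j * fps_nth f j)" if "j \<le> n" for j
    using that by (simp add: binomial_fact field_simps)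
  then show ?thesis
    by (subst mult.commute) (simp add: fps_mult_nth sum_distrib_left)
qed

text \<open>This is the functional equation \<open>exp t * F(-H) = exp ((1 - x) H)\<close> that links the two families
  of polynomials.\<close>

lemma Bell_fps_eq_exp_mult_derangement_fps:
  "fps_exp (1 - x) oo (fps_exp 1 - 1)
   = fps_exp 1 * (Abs_fps (\<lambda>n. derangement_poly n x / fact n) oo (- (fps_exp 1 - 1)))"
proof -
  let ?H = "fps_exp 1 - 1 :: real fps"
  let ?F = "Abs_fps (\<lambda>n. derangement_poly n x / fact n)"
  have H0: "fps_nth (- ?H) 0 = 0"
    by simp
  have "?F = fps_exp (x - 1) / (1 - fps_X)"
    unfolding derangement_poly_egf[symmetric]
    by (simp add: fps_divide_unit mult.assoc mult.left_commute fps_exp_add_mult[symmetric] algebra_simps)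
  then have "(1 - fps_X) * ?F = fps_exp (x - 1)"
    by (simp add: fps_divide_unit inverse_mult_eq_1' mult.left_commute)
  then have "((1 - fps_X) oo (- ?H)) * (?F oo (- ?H)) = fps_exp (x - 1) oo (- ?H)"
    using fps_compose_mult_distrib[OF H0] by metis
  moreover have "(1 - fps_X) oo (- ?H) = fps_exp 1"
    using H0 by (simp add: fps_compose_sub_distrib)
  moreover have "fps_exp (x - 1) oo (- ?H) = fps_exp (1 - x) oo ?H"
  proof (rule fps_ext)
    fix n
    have "(x - 1) ^ k * fps_nth ((- ?H) ^ k) n = (1 - x) ^ k * fps_nth (?H ^ k) n" for k
      using power_mult_distrib[of "x - 1" "- 1" k] unfolding fps_nth_power_minus by simp
    then show "fps_nth (fps_exp (x - 1) oo (- ?H)) n = fps_nth (fps_exp (1 - x) oo ?H) n"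
      by (simp add: fps_compose_nth)
  qed
  ultimately show ?thesis
    by simp
qed

text \<open>The sum \<open>T(n, k)\<close> is the coefficient of \<open>(x)\<^sub>k\<close> in the expansion of \<open>(x)\<^sub>n\<close> through powers of
  \<open>x\<close> and back. The recurrences of both kinds combine to
  \<open>T(n + 1, k) = T(n, k - 1) + (k - n) T(n, k)\<close>, which the Kronecker delta satisfies.\<close>

lemma sum_signed_stirling_Stirling:
  "(\<Sum>l=0..n. signed_stirling n l * int (Stirling l k)) = (if n = k then 1 else 0)"
proof (induction n arbitrary: k)
  case 0
  show ?case
    by (cases k) (simp_all add: signed_stirling_0)
next
  case (Suc n)
  have "(\<Sum>l=0..Suc n. signed_stirling (Suc n) l * int (Stirling l k))
      = (\<Sum>l=0..Suc n. (if l = 0 then 0 else signed_stirling n (l - 1)) * int (Stirling l k))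
        - (\<Sum>l=0..Suc n. int n * (signed_stirling n l * int (Stirling l k)))"
    by (subst sum_subtractf [symmetric], rule sum.cong)
       (simp_all add: signed_stirling_Suc algebra_simps)
  also have "\<dots> = (\<Sum>l=0..n. signed_stirling n l * int (Stirling (Suc l) k))
      - int n * (\<Sum>l=0..n. signed_stirling n l * int (Stirling l k))"
    by (subst sum.atLeast0_atMost_Suc_shift) (simp add: sum_distrib_left)
  also have "\<dots> = (if Suc n = k then 1 else 0)"
  proof (cases k)
    case 0
    then show ?thesis
      by (simp add: Suc)
  next
    case (Suc m)
    have "(\<Sum>l=0..n. signed_stirling n l * int (Stirling (Suc l) (Suc m)))
        = (\<Sum>l=0..n. signed_stirling n l * int (Stirling l m))
          + int (Suc m) * (\<Sum>l=0..n. signed_stirling n l * int (Stirling l (Suc m)))"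
      by (simp add: sum_distrib_left sum.distrib[symmetric] algebra_simps)
    then show ?thesis
      using Suc by (simp add: Suc.IH)
  qed
  finally show ?case .
qed

text \<open>The inner sums \<open>\<Sum>k=0..l\<close> may all be extended to \<open>\<Sum>k=0..n\<close> because \<open>S\<^sub>2(l, k) = 0\<close> for
  \<open>k > l\<close>; after exchanging the two summations, orthogonality leaves only the term \<open>k = n\<close>.\<close>

lemma Stirling_inversion:
  fixes a :: "nat \<Rightarrow> real"
  shows "(\<Sum>l=0..n. real_of_int (signed_stirling n l) * (\<Sum>k=0..l. a k * real (Stirling l k))) = a n"
proof -
  have "(\<Sum>k=0..l. a k * real (Stirling l k)) = (\<Sum>k=0..n. a k * real (Stirling l k))"
    if "l \<le> n" for l
    using that by (intro sum.mono_neutral_left) auto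
  then have "(\<Sum>l=0..n. real_of_int (signed_stirling n l) * (\<Sum>k=0..l. a k * real (Stirling l k)))
      = (\<Sum>l=0..n. \<Sum>k=0..n. a k * real_of_int (signed_stirling n l * int (Stirling l k)))"
    by (simp add: sum_distrib_left mult_ac)
  also have "\<dots> = (\<Sum>k=0..n. a k * real_of_int (\<Sum>l=0..n. signed_stirling n l * int (Stirling l k)))"
    by (subst sum.swap) (simp add: sum_distrib_left)
  also have "\<dots> = a n"
    by (simp only: sum_signed_stirling_Stirling) (simp add: if_distrib cong: if_cong)
  finally show ?thesis .
qed

theorem theorem2:
  fixes n :: nat and x :: real
  shows "Bell_poly n (1 - x) =
           (\<Sum>j=0..n. \<Sum>l=0..j.
              real (n choose j) * (- 1) ^ l * derangement_poly l x * real (Stirling j l)) \<and>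
         derangement_poly n x =
           (\<Sum>l=0..n. \<Sum>m=0..l.
              real (l choose m) * Bell_poly m (1 - x) * (- 1) powi (int n - int m - int l)
                * real_of_int (signed_stirling n l))"
proof
  define G where
    "G = Abs_fps (\<lambda>n. derangement_poly n x / fact n) oo (- (fps_exp 1 - 1 :: real fps))"
  have G_nth: "fact j * fps_nth G j
      = (\<Sum>l=0..j. (- 1) ^ l * derangement_poly l x * real (Stirling j l))" for j
    unfolding G_def by (rule fps_compose_minus_exp_minus_one_nth)
  have Bell_fps: "fps_exp (1 - x) oo (fps_exp 1 - 1) = fps_exp 1 * G"
    unfolding G_def by (rule Bell_fps_eq_exp_mult_derangement_fps)
  show "Bell_poly n (1 - x) =
      (\<Sum>j=0..n. \<Sum>l=0..j.
         real (n choose j) * (- 1) ^ l * derangement_poly l x * real (Stirling j l))"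
    unfolding Bell_poly_def Bell_fps fps_exp_mult_nth G_nth
    by (simp add: sum_distrib_left mult.assoc)

  have "G = fps_exp (- 1) * (fps_exp (1 - x) oo (fps_exp 1 - 1))"
    unfolding Bell_fps by (simp add: mult.assoc[symmetric] fps_exp_add_mult[symmetric])
  then have G_nth': "fact l * fps_nth G l
      = (\<Sum>m=0..l. real (l choose m) * (- 1) ^ (l - m) * Bell_poly m (1 - x))" for l
    by (simp only: fps_exp_mult_nth Bell_poly_def)
  \<comment> \<open>The exponent \<open>n - m - l\<close> may be negative; only its parity matters, and it is that of \<open>n + (l - m)\<close>.\<close>
  have sign: "(- 1 :: real) powi (int n - int m - int l) = (- 1) ^ n * (- 1) ^ (l - m)" if "m \<le> l" for l m
    using that by (simp add: power_int_minus_left uminus_power_if)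
  have "(- 1) ^ n * derangement_poly n x
      = (\<Sum>l=0..n. real_of_int (signed_stirling n l) * (fact l * fps_nth G l))"
    unfolding G_nth by (rule Stirling_inversion[symmetric])
  then have "derangement_poly n x
      = (- 1) ^ n * (\<Sum>l=0..n. real_of_int (signed_stirling n l) * (fact l * fps_nth G l))"
    by (metis mult.assoc mult.left_neutral left_minus_one_mult_self)
  also have "\<dots> = (\<Sum>l=0..n. \<Sum>m=0..l.
      real (l choose m) * Bell_poly m (1 - x) * (- 1) powi (int n - int m - int l)
        * real_of_int (signed_stirling n l))"
    unfolding G_nth' by (simp add: sum_distrib_left sign mult_ac)
  finally show "derangement_poly n x = \<dots>" .
qed

end
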